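(* Let $f,g:\{0,1\}^n\to\{1,-1\}$ be bent functions given by oracle access, and let $\hat f$ be the dual of $f$. Under the promise that either $g=\hat f$ or $g\oplus\hat f$ is balanced, the problem of finding which of the two cases holds can be decided deterministically (i.e. with probability $1$) by a quantum algorithm making exactly one query to $f$ and one query to $g$.
   Context: The Walsh transform of $f:\{0,1\}^n\to\{1,-1\}$ is $W_f(\boldsymbol{\omega})=\sum_{\mathbf{x}\in\{0,1\}^n}f(\mathbf{x})(-1)^{\mathbf{x}\cdot\boldsymbol{\omega}}$, where $\mathbf{x}\cdot\boldsymbol{\omega}=x_1\omega_1\oplus\cdots\oplus x_n\omega_n$. For $n$ even, $f$ is bent if $W_f(\boldsymbol{\omega})=\pm2^{n/2}$ for all $\boldsymbol{\omega}$. The dual of a bent function $f$ is the bent function $\hat f:\{0,1\}^n\to\{1,-1\}$ with $W_f(\boldsymbol{\omega})=2^{n/2}\hat f(\boldsymbol{\omega})$ and $W_{\hat f}(\boldsymbol{\omega})=2^{n/2}f(\boldsymbol{\omega})$ for all $\boldsymbol{\omega}$. For $\pm1$-valued functions, $f\oplus g$ is the function whose value at $\mathbf{x}$ is the product $f(\mathbf{x})g(\mathbf{x})$ (XOR under the identification $0\leftrightarrow1$, $1\leftrightarrow-1$ of output bits); a function is balanced if it takes each of the values $1$ and $-1$ on exactly $2^{n-1}$ inputs. Quantum query (black-box) model: a query to $h:\{0,1\}^n\to\{1,-1\}$ is one application of the unitary $U_h|\mathbf{x}\rangle|a\rangle=|\mathbf{x}\rangle\left|a\oplus\frac{1-h(\mathbf{x})}{2}\right\rangle$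 on $n+1$ qubits; between queries arbitrary unitaries independent of the oracle functions may be applied, and at the end a measurement is made. *)

theory Defs
  imports "HOL-Analysis.Analysis" "HOL-Library.Z2"
begin

section \<open>Bent functions\<close>

text \<open>
  The cube $\{0,1\}^n$ is \<^typ>\<open>bit^'n\<close> with $n$ = \<^term>\<open>CARD('n)\<close>; addition on \<^typ>\<open>bit\<close> is XOR.
\<close>

instance bit :: finite
proof
  have "(UNIV :: bit set) = {0, 1}"
    by (auto intro: bit.exhaust)
  then show "finite (UNIV :: bit set)"
    by (metis finite.emptyI finite.insertI)
qed

definition dot :: "bit^'n \<Rightarrow> bit^'n \<Rightarrow> bit" where
  "dot x w = (\<Sum>i\<in>UNIV. x $ i * w $ i)"

definition walsh :: "(bit^'n \<Rightarrow> int) \<Rightarrow> bit^'n \<Rightarrow> int" where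
  "walsh f w = (\<Sum>x\<in>UNIV. f x * (- 1) ^ of_bit (dot x w))"

definition pm1_valued :: "(bit^'n \<Rightarrow> int) \<Rightarrow> bool" where
  "pm1_valued f \<longleftrightarrow> range f \<subseteq> {1, - 1}"

definition bent :: "(bit^'n \<Rightarrow> int) \<Rightarrow> bool" where
  "bent f \<longleftrightarrow> even CARD('n) \<and> pm1_valued f \<and>
     (\<forall>w. walsh f w = 2 ^ (CARD('n) div 2) \<or> walsh f w = - (2 ^ (CARD('n) div 2)))"

definition is_dual :: "(bit^'n \<Rightarrow> int) \<Rightarrow> (bit^'n \<Rightarrow> int) \<Rightarrow> bool" where
  "is_dual f h \<longleftrightarrow> bent h \<and>
     (\<forall>w. walsh f w = 2 ^ (CARD('n) div 2) * h w) \<and>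
     (\<forall>w. walsh h w = 2 ^ (CARD('n) div 2) * f w)"

text \<open>Meaningful for bent \<open>f\<close> only; see \<open>is_dual_dual\<close> below.\<close>

definition dual :: "(bit^'n \<Rightarrow> int) \<Rightarrow> bit^'n \<Rightarrow> int" where
  "dual f = (THE h. is_dual f h)"

text \<open>XOR of output bits under $0 \leftrightarrow 1$, $1 \leftrightarrow -1$.\<close>

definition xor_pm :: "(bit^'n \<Rightarrow> int) \<Rightarrow> (bit^'n \<Rightarrow> int) \<Rightarrow> bit^'n \<Rightarrow> int" where
  "xor_pm f g x = f x * g x"

definition balanced :: "(bit^'n \<Rightarrow> int) \<Rightarrow> bool" where
  "balanced f \<longleftrightarrow> card {x. f x = 1} = 2 ^ (CARD('n) - 1) \<and>
     card {x. f x = - 1} = 2 ^ (CARD('n) - 1)"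

lemma sign_add: "(- 1 :: int) ^ of_bit (a + b) = (- 1) ^ of_bit a * (- 1) ^ of_bit b"
  by (cases a; cases b) simp_all

lemma dot_commute: "dot x w = dot w x"
  unfolding dot_def by (rule sum.cong) (auto simp del: mult_bit_eq_and simp: mult.commute)

lemma dot_add_right: "dot x (u + w) = dot x u + dot x w"
  unfolding dot_def
  by (simp add: distrib_left sum.distrib del: mult_bit_eq_and add_bit_eq_xor)

lemma dot_axis: "dot x (axis i 1) = x $ i"
proof -
  have "dot x (axis i 1) = (\<Sum>j\<in>UNIV. if i = j then x $ j else 0)"
    unfolding dot_def
    by (rule sum.cong) (auto simp: axis_def)
  then show ?thesis by simp
qed

lemma sum_sign:
  fixes u :: "bit^'n"
  shows "(\<Sum>x\<in>UNIV. (- 1 :: int) ^ of_bit (dot x u)) = (if u = 0 then 2 ^ CARD('n) else 0)"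
proof (cases "u = 0")
  case True
  have "(UNIV :: bit set) = {0, 1}" by (auto intro: bit.exhaust)
  then have "CARD(bit) = 2" by (metis card_2_iff zero_neq_one)
  then have "CARD(bit^'n) = 2 ^ CARD('n)" by simp
  then show ?thesis using True by (simp add: dot_def)
next
  case False
  then obtain i where "u $ i \<noteq> 0" by (auto simp: vec_eq_iff)
  then have i: "u $ i = 1" by simp
  let ?s = "\<lambda>x. (- 1 :: int) ^ of_bit (dot x u)"
  have "sum ?s UNIV = (\<Sum>x\<in>UNIV. ?s (x + axis i 1))"
    by (rule sum.reindex_bij_witness[of _ "\<lambda>x. x + axis i 1" "\<lambda>x. x - axis i 1"])
       (simp_all only: diff_add_cancel add_diff_cancel UNIV_I)
  also have "\<dots> = (\<Sum>x\<in>UNIV. - ?s x)"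
  proof (rule sum.cong[OF refl])
    fix x
    have "dot (x + axis i 1) u = dot x u + 1"
      using i by (metis dot_commute dot_add_right dot_axis)
    then have "?s (x + axis i 1) = ?s x * (- 1) ^ of_bit (1 :: bit)"
      by (simp only: sign_add)
    then show "?s (x + axis i 1) = - ?s x" by simp
  qed
  finally show ?thesis using False by (simp add: sum_negf)
qed

lemma walsh_walsh:
  fixes f :: "bit^'n \<Rightarrow> int"
  shows "walsh (walsh f) w = 2 ^ CARD('n) * f w"
proof -
  have *: "u + w = 0 \<longleftrightarrow> u = w" for u :: "bit^'n"
  proof -
    have "w + w = 0"
      by (simp add: vec_eq_iff)
    then show ?thesis
      by (metis add_right_cancel)
  qed
  have "walsh f x * (- 1) ^ of_bit (dot x w) =
      (\<Sum>u\<in>UNIV. f u * (- 1) ^ of_bit (dot x (u + w)))" for x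
    unfolding walsh_def sum_distrib_right dot_add_right sign_add dot_commute[of _ x]
    by (simp only: mult.assoc)
  then have "walsh (walsh f) w =
      (\<Sum>x\<in>UNIV. \<Sum>u\<in>UNIV. f u * (- 1) ^ of_bit (dot x (u + w)))"
    unfolding walsh_def[of "walsh f"] by (rule sum.cong[OF refl])
  also have "\<dots> = (\<Sum>u\<in>UNIV. f u * (\<Sum>x\<in>UNIV. (- 1) ^ of_bit (dot x (u + w))))"
    unfolding sum_distrib_left by (rule sum.swap)
  also have "\<dots> = (\<Sum>u\<in>UNIV. if u = w then 2 ^ CARD('n) * f u else 0)"
    unfolding sum_sign * by (rule sum.cong) auto
  finally show ?thesis by simp
qed

lemma ex1_dual:
  fixes f :: "bit^'n \<Rightarrow> int"
  assumes "bent f"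
  shows "\<exists>!h. is_dual f h"
proof -
  let ?N = "2 ^ (CARD('n) div 2) :: int"
  define h where "h = (\<lambda>w. walsh f w div ?N)"
  have ev: "even CARD('n)" and pm: "\<And>x. f x = 1 \<or> f x = - 1"
    using assms by (auto simp: bent_def pm1_valued_def)
  have W: "walsh f w = ?N * h w" and h: "h w = 1 \<or> h w = - 1" for w
  proof -
    have "walsh f w = ?N * 1 \<or> walsh f w = ?N * (- 1)"
      using assms by (simp add: bent_def)
    then show "walsh f w = ?N * h w" and "h w = 1 \<or> h w = - 1"
      unfolding h_def by (metis nonzero_mult_div_cancel_left power_not_zero zero_neq_numeral)+
  qed
  have NN: "2 ^ CARD('n) = ?N * ?N"
    using ev by (metis dvd_mult_div_cancel mult_2 power_add)
  have "?N * walsh h w = walsh (walsh f) w" for w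
    by (simp add: walsh_def[of "walsh f"] walsh_def[of h] W sum_distrib_left mult.assoc)
  then have Wh: "walsh h w = ?N * f w" for w
    by (simp add: walsh_walsh NN)
  have "bent h"
    unfolding bent_def pm1_valued_def using ev h pm by (force simp: Wh)
  then have "is_dual f h" using W Wh by (auto simp: is_dual_def)
  moreover have "h' = h" if "is_dual f h'" for h'
    using that W by (auto simp: is_dual_def)
  ultimately show ?thesis by blast
qed

lemma is_dual_dual: "bent f \<Longrightarrow> is_dual f (dual f)"
  unfolding dual_def by (rule theI'[OF ex1_dual])

section \<open>Quantum query algorithms\<close>

text \<open>
  Computational basis states \<open>|x\<rangle>|a\<rangle>\<close> of \<open>n + 1\<close> qubits, and matrices in this basis.
\<close>

type_synonym 'n basis = "(bit^'n) \<times> bit"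
type_synonym 'n state = "complex^('n basis)"
type_synonym 'n operator = "complex^('n basis)^('n basis)"

definition conj_transpose :: "complex^'a^'b \<Rightarrow> complex^'b^'a" where
  "conj_transpose A = (\<chi> i j. cnj (A $ j $ i))"

definition unitary :: "complex^'a^'a \<Rightarrow> bool" where
  "unitary U \<longleftrightarrow> conj_transpose U ** U = mat 1 \<and> U ** conj_transpose U = mat 1"

text \<open>Column \<open>c\<close> of the matrix is the image of the basis state \<open>c\<close>.\<close>

definition query_op :: "(bit^'n \<Rightarrow> int) \<Rightarrow> 'n operator" where
  "query_op h = (\<chi> r c. case c of (x, a) \<Rightarrow>
     if r = (x, a + of_int ((1 - h x) div 2)) then 1 else 0)"

text \<open>
  An algorithm is a list of steps, executed from left to right on the initial state
  \<open>|0\<dots>0\<rangle>|0\<rangle>\<close>. The matrices in \<open>Apply\<close> steps are part of the list, hence do not depend on the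
  oracle functions.
\<close>

datatype 'n step = Apply "'n::finite operator" | Query_f | Query_g

fun step_op :: "(bit^'n \<Rightarrow> int) \<Rightarrow> (bit^'n \<Rightarrow> int) \<Rightarrow> 'n::finite step \<Rightarrow> 'n operator" where
  "step_op f g (Apply U) = U"
| "step_op f g Query_f = query_op f"
| "step_op f g Query_g = query_op g"

definition quantum_algorithm :: "'n::finite step list \<Rightarrow> bool" where
  "quantum_algorithm ss \<longleftrightarrow> (\<forall>U. Apply U \<in> set ss \<longrightarrow> unitary U)"

definition final_state ::
  "(bit^'n \<Rightarrow> int) \<Rightarrow> (bit^'n \<Rightarrow> int) \<Rightarrow> 'n::finite step list \<Rightarrow> 'n state" where
  "final_state f g ss = fold (\<lambda>s \<psi>. step_op f g s *v \<psi>) ss (axis (0, 0) 1)"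

text \<open>
  Born rule: probability that measuring all qubits in the computational basis yields an
  outcome in \<open>E\<close>.
\<close>

definition measure_prob :: "'n::finite state \<Rightarrow> 'n basis set \<Rightarrow> real" where
  "measure_prob \<psi> E = (\<Sum>b\<in>E. (cmod (\<psi> $ b))\<^sup>2)"

end

theory Submission
  imports Defs
begin

text \<open>
  Prepare the target qubit in the state \<open>|-\<rangle>\<close>, so that a query multiplies the amplitude of
  \<open>|x\<rangle>\<close> by the oracle value. A Hadamard transform after the query to \<open>f\<close> turns the amplitudes
  \<open>f x\<close> into those of the dual, because the Walsh spectrum of a bent function is flat. The query
  to \<open>g\<close> and a second Hadamard transform then leave at \<open>x = 0\<close> the correlation of \<open>g\<close> with the
  dual of \<open>f\<close>, whose modulus is 1 in the first case and 0 in the second.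
\<close>

lemma UNIV_bit: "(UNIV :: bit set) = {0, 1}"
  by (auto intro: bit.exhaust)

lemma card_bit [simp]: "CARD(bit) = 2"
  by (simp add: UNIV_bit)

lemma sum_bit: "(\<Sum>a\<in>UNIV. F (a :: bit)) = F 0 + F 1"
  by (simp add: UNIV_bit)

lemma all_bit: "(\<forall>a. P (a :: bit)) \<longleftrightarrow> P 0 \<and> P 1"
  by (metis bit.exhaust)

lemma sum_basis:
  "(\<Sum>b\<in>UNIV. F (b :: 'n::finite basis)) = (\<Sum>x\<in>UNIV. F (x, 0) + F (x, 1))"
  by (simp add: UNIV_Times_UNIV[symmetric] sum.cartesian_product' sum_bit del: UNIV_Times_UNIV)

lemma vec_bit_add_self: "(w :: bit^'n) + w = 0"
  by (simp add: vec_eq_iff)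

lemma vec_bit_add_eq_0_iff: "u + w = 0 \<longleftrightarrow> u = (w :: bit^'n)"
  using vec_bit_add_self by (metis add_right_cancel)

text \<open>Expanding one factor of each square and exchanging the sums turns the other factor into
  \<open>walsh (walsh F)\<close>, which inversion evaluates. This gives the total weight of the
  final state, and hence the weight outside an event.\<close>

lemma walsh_parseval:
  fixes F :: "bit^'n \<Rightarrow> int"
  shows "(\<Sum>w\<in>UNIV. (walsh F w)\<^sup>2) = 2 ^ CARD('n) * (\<Sum>x\<in>UNIV. (F x)\<^sup>2)"
proof -
  have "(\<Sum>w\<in>UNIV. (walsh F w)\<^sup>2) =
      (\<Sum>w\<in>UNIV. \<Sum>x\<in>UNIV. F x * (walsh F w * (- 1) ^ of_bit (dot w x)))"
  proof (rule sum.cong[OF refl])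
    fix w
    have "(walsh F w)\<^sup>2 = walsh F w * (\<Sum>x\<in>UNIV. F x * (- 1) ^ of_bit (dot w x))"
      unfolding power2_eq_square by (simp only: walsh_def dot_commute)
    then show "(walsh F w)\<^sup>2 = (\<Sum>x\<in>UNIV. F x * (walsh F w * (- 1) ^ of_bit (dot w x)))"
      by (simp only: sum_distrib_left mult.left_commute)
  qed
  also have "\<dots> = (\<Sum>x\<in>UNIV. F x * walsh (walsh F) x)"
    unfolding walsh_def[of "walsh F"] sum_distrib_left by (rule sum.swap)
  also have "\<dots> = 2 ^ CARD('n) * (\<Sum>x\<in>UNIV. (F x)\<^sup>2)"
    by (simp add: walsh_walsh sum_distrib_left power2_eq_square ac_simps)
  finally show ?thesis .
qed

lemma pm1_valued_cases: "pm1_valued f \<Longrightarrow> f x = 1 \<or> f x = - 1"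
  by (auto simp: pm1_valued_def)

lemma pm1_valued_xor_pm:
  assumes "pm1_valued f" "pm1_valued g"
  shows "pm1_valued (xor_pm f g)"
proof -
  have "xor_pm f g x \<in> {1, - 1}" for x
    using pm1_valued_cases[OF assms(1), of x] pm1_valued_cases[OF assms(2), of x]
    by (auto simp: xor_pm_def)
  then show ?thesis
    unfolding pm1_valued_def by blast
qed

lemma sum_balanced:
  fixes h :: "bit^'n \<Rightarrow> int"
  assumes "pm1_valued h" "balanced h"
  shows "(\<Sum>x\<in>UNIV. h x) = 0"
proof -
  have "(\<Sum>x\<in>UNIV. h x) =
      (\<Sum>x\<in>UNIV. (if h x = 1 then 1 else 0) - (if h x = - 1 then 1 else 0))"
    using pm1_valued_cases[OF assms(1)] by (intro sum.cong) force+
  also have "\<dots> = int (card {x. h x = 1}) - int (card {x. h x = - 1})"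
    by (simp add: sum_subtractf sum.If_cases)
  finally show ?thesis
    using assms(2) by (simp add: balanced_def)
qed

text \<open>Hadamard gates on the n input qubits, tensored with a gate \<open>K\<close> on the
  target qubit; \<open>K = mat 1\<close> leaves the target alone.\<close>

definition hadamard_tensor :: "complex^bit^bit \<Rightarrow> 'n::finite operator" where
  "hadamard_tensor K = (\<chi> r c.
     (- 1) ^ of_bit (dot (fst r) (fst c)) / complex_of_real (sqrt (2 ^ CARD('n))) * K $ snd r $ snd c)"

lemma complex_sqrt_mult_self: "0 \<le> a \<Longrightarrow> complex_of_real (sqrt a) * complex_of_real (sqrt a) = of_real a"
  by (simp flip: of_real_mult)

text \<open>On the input register the transform is its own inverse by orthogonality of characters,
  and the target gates multiply separately. With \<open>L\<close> or \<open>K\<close> a conjugate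
  transpose this yields both halves of unitarity.\<close>

lemma hadamard_tensor_mult:
  assumes "K ** L = mat 1"
  shows "hadamard_tensor K ** hadamard_tensor L = (mat 1 :: 'n::finite operator)"
proof -
  let ?s = "complex_of_real (sqrt (2 ^ CARD('n)))"
  let ?e = "\<lambda>u v :: bit^'n. (- 1 :: complex) ^ of_bit (dot u v)"
  have KL: "K $ a $ 0 * L $ 0 $ b + K $ a $ 1 * L $ 1 $ b = (if a = b then 1 else 0)" for a b
    using assms by (auto simp: vec_eq_iff matrix_matrix_mult_def sum_bit mat_def)
  have s: "?s * ?s = 2 ^ CARD('n)"
    by (simp add: complex_sqrt_mult_self)
  have e: "(\<Sum>y\<in>UNIV. ?e x y * ?e y z) = (if x = z then ?s * ?s else 0)" for x z
  proof -
    \<comment> \<open>The signs are pulled back to the integers, where \<open>sign_add\<close> and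
      \<open>sum_sign\<close> are stated.\<close>
    have "?e x y * ?e y z = of_int ((- 1) ^ of_bit (dot y (x + z)))" for y
      unfolding dot_add_right sign_add by (simp add: dot_commute)
    then have "(\<Sum>y\<in>UNIV. ?e x y * ?e y z) = of_int (\<Sum>y\<in>UNIV. (- 1) ^ of_bit (dot y (x + z)))"
      by (simp only: of_int_sum)
    then show ?thesis
      unfolding sum_sign vec_bit_add_eq_0_iff s by simp
  qed
  have "(hadamard_tensor K ** hadamard_tensor L :: 'n operator) $ (x, a) $ (z, b) = mat 1 $ (x, a) $ (z, b)"
    for x z a b
  proof -
    have "(hadamard_tensor K ** hadamard_tensor L :: 'n operator) $ (x, a) $ (z, b) =
        (\<Sum>y\<in>UNIV. ?e x y * ?e y z * (K $ a $ 0 * L $ 0 $ b + K $ a $ 1 * L $ 1 $ b) / (?s * ?s))"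
      unfolding matrix_matrix_mult_def hadamard_tensor_def
      by (simp add: sum_basis algebra_simps add_divide_distrib)
    also have "\<dots> = (\<Sum>y\<in>UNIV. ?e x y * ?e y z) * (if a = b then 1 else 0) / (?s * ?s)"
      unfolding KL sum_distrib_right sum_divide_distrib ..
    finally show ?thesis
      unfolding e by (simp add: mat_def)
  qed
  then show ?thesis
    by (simp add: vec_eq_iff)
qed

lemma conj_transpose_hadamard_tensor:
  "conj_transpose (hadamard_tensor K) = hadamard_tensor (conj_transpose K)"
  by (simp add: conj_transpose_def hadamard_tensor_def vec_eq_iff dot_commute)

lemma unitary_hadamard_tensor: "unitary K \<Longrightarrow> unitary (hadamard_tensor K)"
  by (simp add: unitary_def conj_transpose_hadamard_tensor hadamard_tensor_mult)

lemma unitary_mat_1: "unitary (mat 1 :: complex^'a::finite^'a)"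
proof -
  have "conj_transpose (mat 1) = (mat 1 :: complex^'a^'a)"
    by (auto simp: conj_transpose_def mat_def vec_eq_iff)
  then show ?thesis
    by (simp add: unitary_def)
qed

text \<open>The Hadamard gate preceded by a bit flip, hence mapping \<open>|0\<rangle>\<close> to \<open>|-\<rangle>\<close>.\<close>

definition minus_gate :: "complex^bit^bit" where
  "minus_gate = (\<chi> a b. (if a = 1 \<and> b = 0 then - 1 else 1) / complex_of_real (sqrt 2))"

lemma unitary_minus_gate: "unitary minus_gate"
  by (simp add: unitary_def minus_gate_def conj_transpose_def matrix_matrix_mult_def mat_def
      vec_eq_iff sum_bit complex_sqrt_mult_self all_bit)

text \<open>The target qubit is in the state \<open>|-\<rangle>\<close>, with its normalization absorbed into \<open>c\<close>.\<close>

definition kick_state :: "complex \<Rightarrow> (bit^'n \<Rightarrow> int) \<Rightarrow> 'n::finite state" where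
  "kick_state c F = (\<chi> b. c * of_int (F (fst b)) * (- 1) ^ of_bit (snd b))"

lemma matrix_vector_mult_axis: "((A :: complex^'a::finite^'b) *v axis k 1) $ i = A $ i $ k"
  by (simp add: matrix_vector_mult_def axis_def if_distrib cong: if_cong)

lemma hadamard_minus_init:
  "hadamard_tensor minus_gate *v axis (0, 0) 1 =
    (kick_state (1 / (complex_of_real (sqrt (2 ^ CARD('n))) * complex_of_real (sqrt 2))) (\<lambda>_. 1)
      :: 'n::finite state)"
proof -
  have "hadamard_tensor minus_gate $ (x, a) $ (0, 0) =
    (kick_state (1 / (complex_of_real (sqrt (2 ^ CARD('n))) * complex_of_real (sqrt 2))) (\<lambda>_. 1)
      :: 'n::finite state) $ (x, a)" for x a
    by (cases a) (simp_all add: hadamard_tensor_def minus_gate_def kick_state_def dot_def)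
  then show ?thesis
    by (simp add: vec_eq_iff matrix_vector_mult_axis)
qed

text \<open>The normalization goes into \<open>c\<close>, so the function part stays integer-valued
  and the integer Walsh identities apply to it.\<close>

lemma hadamard_kick_state:
  fixes F :: "bit^'n::finite \<Rightarrow> int"
  shows "hadamard_tensor (mat 1) *v kick_state c F =
    kick_state (c / complex_of_real (sqrt (2 ^ CARD('n)))) (walsh F)"
proof -
  have "(hadamard_tensor (mat 1) *v kick_state c F) $ (x, a) =
    kick_state (c / complex_of_real (sqrt (2 ^ CARD('n)))) (walsh F) $ (x, a)" for x a
    by (cases a) (simp_all add: matrix_vector_mult_def hadamard_tensor_def kick_state_def sum_basis
        mat_def walsh_def sum_distrib_left sum_distrib_right sum_divide_distrib sum_negf
        dot_commute[of x] ac_simps)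
  then show ?thesis
    by (simp add: vec_eq_iff)
qed

text \<open>Phase kickback: the query flips the target exactly where \<open>h x = - 1\<close>, and a
  flip negates \<open>(- 1) ^ of_bit a\<close>.\<close>

lemma query_kick_state:
  assumes "pm1_valued h"
  shows "query_op h *v kick_state c F = kick_state c (\<lambda>x. F x * h x)"
proof -
  have "(query_op h *v kick_state c F) $ (x, a) = kick_state c (\<lambda>x. F x * h x) $ (x, a)" for x a
  proof -
    \<comment> \<open>Adding a bit is an involution, so the only nonzero entry of row
      \<open>(x, a)\<close> lies in the column reached by the same shift.\<close>
    have "(query_op h *v kick_state c F) $ (x, a) =
        (\<Sum>y\<in>UNIV. if y = x then kick_state c F $ (x, a + of_int ((1 - h x) div 2)) else 0)"
      unfolding matrix_vector_mult_def query_op_def sum_basis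
      using pm1_valued_cases[OF assms, of x]
      by (cases a) (auto intro!: sum.cong simp del: sum.delta sum.delta')
    then show ?thesis
      using pm1_valued_cases[OF assms, of x] by (cases a) (auto simp: kick_state_def)
  qed
  then show ?thesis
    by (simp add: vec_eq_iff)
qed

lemma measure_prob_kick_state_UNIV:
  fixes F :: "bit^'n::finite \<Rightarrow> int"
  shows "measure_prob (kick_state c F) UNIV = 2 * (cmod c)\<^sup>2 * of_int (\<Sum>x\<in>UNIV. (F x)\<^sup>2)"
  by (simp add: measure_prob_def kick_state_def sum_basis norm_mult power_mult_distrib
      sum_distrib_left mult.assoc)

lemma measure_prob_kick_state_0:
  fixes F :: "bit^'n::finite \<Rightarrow> int"
  shows "measure_prob (kick_state c F) {(0, 0), (0, 1)} = 2 * (cmod c)\<^sup>2 * of_int ((F 0)\<^sup>2)"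
  by (simp add: measure_prob_def kick_state_def norm_mult power_mult_distrib)

lemma measure_prob_Compl: "measure_prob \<psi> (- E) = measure_prob \<psi> UNIV - measure_prob \<psi> E"
  by (simp add: measure_prob_def Compl_eq_Diff_UNIV sum_diff)

definition duality_test :: "'n::finite step list" where
  "duality_test = [Apply (hadamard_tensor minus_gate), Query_f, Apply (hadamard_tensor (mat 1)),
     Query_g, Apply (hadamard_tensor (mat 1))]"

lemma quantum_algorithm_duality_test: "quantum_algorithm duality_test"
  by (auto simp: quantum_algorithm_def duality_test_def unitary_hadamard_tensor unitary_minus_gate
      unitary_mat_1)

text \<open>Each of the three Hadamard layers contributes one factor
  \<open>sqrt (2 ^ CARD('n))\<close> to the denominator; \<open>sqrt 2\<close> normalizes the target
  qubit.\<close>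

lemma final_state_duality_test:
  fixes f g :: "bit^'n::finite \<Rightarrow> int"
  assumes "pm1_valued f" "pm1_valued g"
  shows "final_state f g duality_test =
    kick_state (1 / (complex_of_real (sqrt (2 ^ CARD('n))) ^ 3 * complex_of_real (sqrt 2)))
      (walsh (\<lambda>w. walsh f w * g w))"
  by (simp add: final_state_def duality_test_def hadamard_minus_init hadamard_kick_state
      query_kick_state assms power3_eq_cube ac_simps)

theorem proposition3:
  shows "\<exists>(ss :: 'n::finite step list) (E :: 'n basis set).
    quantum_algorithm ss \<and> count_list ss Query_f = 1 \<and> count_list ss Query_g = 1 \<and>
    (\<forall>f g :: bit^'n \<Rightarrow> int. bent f \<longrightarrow> bent g \<longrightarrow>
       (g = dual f \<longrightarrow> measure_prob (final_state f g ss) E = 1) \<and>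
       (balanced (xor_pm g (dual f)) \<longrightarrow> measure_prob (final_state f g ss) (- E) = 1))"
proof (intro exI conjI allI impI)
  show "quantum_algorithm (duality_test :: 'n step list)"
    by (rule quantum_algorithm_duality_test)
  show "count_list (duality_test :: 'n step list) Query_f = 1"
    and "count_list (duality_test :: 'n step list) Query_g = 1"
    by (simp_all add: duality_test_def)
next
  fix f g :: "bit^'n \<Rightarrow> int"
  assume f: "bent f" and g: "bent g"
  let ?N = "2 ^ CARD('n) :: int" and ?M = "2 ^ (CARD('n) div 2) :: int"
  let ?c = "1 / (complex_of_real (sqrt (2 ^ CARD('n))) ^ 3 * complex_of_real (sqrt 2))"
  let ?F = "walsh (\<lambda>w. walsh f w * g w)"
  \<comment> \<open>The event that the input register reads zero, whatever the target qubit
    shows.\<close>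
  let ?E = "{(0, 0), (0, 1)} :: 'n basis set"
  have pm: "pm1_valued f" "pm1_valued g" "pm1_valued (dual f)"
    and dual: "\<And>w. walsh f w = ?M * dual f w"
    using f g is_dual_dual[OF f] by (auto simp: bent_def is_dual_def)
  have M: "?M\<^sup>2 = ?N"
    using f by (simp add: bent_def flip: power_mult)
  have sq: "(h x)\<^sup>2 = 1" if "pm1_valued h" for h :: "bit^'n \<Rightarrow> int" and x
    using pm1_valued_cases[OF that, of x] by auto
  \<comment> \<open>\<open>?N ^ 3\<close> will be the sum of the squares of \<open>?F\<close>, and 2
    counts the target values: the final state has norm 1.\<close>
  have c: "2 * (cmod ?c)\<^sup>2 * of_int (?N ^ 3) = 1"
  proof -
    have "(sqrt (2 ^ CARD('n)) ^ 3)\<^sup>2 = ((sqrt (2 ^ CARD('n)))\<^sup>2) ^ 3"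
      by (simp only: mult.commute flip: power_mult)
    then have "(sqrt (2 ^ CARD('n)) ^ 3)\<^sup>2 = (2 ^ CARD('n)) ^ 3"
      by simp
    then show ?thesis
      by (simp add: norm_divide norm_mult norm_power power_divide power_mult_distrib)
  qed
  \<comment> \<open>Flatness makes each of the \<open>?N\<close> squares on the other side of
    Parseval equal to \<open>?M\<^sup>2 = ?N\<close>.\<close>
  have F: "(\<Sum>x\<in>UNIV. (?F x)\<^sup>2) = ?N ^ 3"
    unfolding walsh_parseval by (simp add: dual power_mult_distrib sq pm M power3_eq_cube)
  have F0: "?F 0 = ?M * (\<Sum>x\<in>UNIV. xor_pm g (dual f) x)"
    unfolding sum_distrib_left by (simp add: walsh_def[of _ 0] dot_def dual xor_pm_def ac_simps)
  have final: "final_state f g duality_test = kick_state ?c ?F"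
    by (rule final_state_duality_test[OF pm(1,2)])
  show "measure_prob (final_state f g duality_test) ?E = 1" if "g = dual f"
  proof -
    \<comment> \<open>Here the correlation sum is \<open>?N\<close>, so all the weight sits on
      \<open>?E\<close>.\<close>
    have "(?F 0)\<^sup>2 = ?N ^ 3"
      unfolding F0 using that
      by (simp add: xor_pm_def power_mult_distrib M sq pm power3_eq_cube
          flip: power2_eq_square)
    then show ?thesis
      unfolding final measure_prob_kick_state_0 using c by simp
  qed
  show "measure_prob (final_state f g duality_test) (- ?E) = 1" if "balanced (xor_pm g (dual f))"
  proof -
    \<comment> \<open>The correlation vanishes, so \<open>?E\<close> has probability 0 and its
      complement carries the whole norm.\<close>
    have "?F 0 = 0"
      unfolding F0 using sum_balanced[OF pm1_valued_xor_pm[OF pm(2,3)] that] by simp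
    then show ?thesis
      unfolding measure_prob_Compl final measure_prob_kick_state_0 measure_prob_kick_state_UNIV F
      using c by simp
  qed
qed

end
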